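(* Let $N \ge 1$ be an integer and let $A \in \mathbb{C}^{2N \times 2N}$ be a symplectic matrix, i.e. $A^T J A = J$ where $J = \begin{bmatrix} O & I_N \\ -I_N & O \end{bmatrix}$. Then $\det(A) = 1$.
   Context: $I_N$ denotes the $N \times N$ identity matrix, $O$ the $N \times N$ zero matrix, and $A^T$ the transpose of $A$ (without complex conjugation). The set of $2N\times 2N$ symplectic matrices over a field $\mathbb{K}$, i.e. matrices $A \in \mathbb{K}^{2N\times 2N}$ with $A^T J A = J$, is denoted $Sp(2N,\mathbb{K})$; here $\mathbb{K} = \mathbb{C}$. *)

theory Defs
  imports Complex_Main "Jordan_Normal_Form.Determinant"
begin

definition symplectic_J :: "nat \<Rightarrow> 'a :: field mat" where
  "symplectic_J N = four_block_mat (0\<^sub>m N N) (1\<^sub>m N) (- 1\<^sub>m N) (0\<^sub>m N N)"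

text \<open>The set \<open>Sp(2N, K)\<close> over the field \<open>K = 'a\<close>. The transpose is the plain one,
  without conjugation, also for complex matrices.\<close>

definition Sp :: "nat \<Rightarrow> 'a :: field mat set" where
  "Sp N = {A \<in> carrier_mat (2 * N) (2 * N).
     transpose_mat A * symplectic_J N * A = symplectic_J N}"

end

theory Submission
  imports Defs
begin

text \<open>The Pfaffian, written as an unnormalised sum over all permutations so that it makes sense over
  any commutative ring, satisfies \<open>Pf (A\<^sup>T B A) = det A * Pf B\<close>. For symplectic \<open>A\<close> this reads
  \<open>Pf J = det A * Pf J\<close>. Every nonzero term of \<open>Pf J\<close> equals \<open>1\<close>, so \<open>Pf J\<close> is a positive integer
  and cancels in characteristic \<open>0\<close>.\<close>

text \<open>The index \<open>i < N\<close> is paired with \<open>i + N\<close>, matching the block structure of \<open>J\<close>. On alternating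
  matrices the value is \<open>2 ^ N * fact N\<close> times the usual Pfaffian, up to a sign depending on \<open>N\<close>.\<close>

definition pfaffian_sum :: "nat \<Rightarrow> 'a :: comm_ring_1 mat \<Rightarrow> 'a" where
  "pfaffian_sum N B =
     (\<Sum>p | p permutes {0..<2 * N}. signof p * (\<Prod>i<N. B $$ (p i, p (i + N))))"

lemma prod_lessThan_double:
  fixes f :: "nat \<Rightarrow> 'a :: comm_monoid_mult"
  shows "(\<Prod>i = 0..<2 * N. f i) = (\<Prod>i<N. f i * f (i + N))"
proof -
  have "(\<Prod>i = 0..<2 * N. f i) = (\<Prod>i = 0..<N. f i) * (\<Prod>i = N..<N + N. f i)"
    by (simp add: prod.atLeastLessThan_concat mult_2)
  also have "(\<Prod>i = N..<N + N. f i) = (\<Prod>i = 0..<N. f (i + N))"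
    using prod.shift_bounds_nat_ivl[of f 0 N N] by simp
  finally show ?thesis
    by (simp add: prod.distrib lessThan_atLeast0)
qed

text \<open>Selecting rows is left multiplication by the 0/1 matrix whose row \<open>i\<close> is
  the unit vector with index \<open>r i\<close>. When \<open>r\<close> repeats a value, both
  determinants of selections vanish.\<close>

lemma det_select_rows:
  fixes A :: "'a :: comm_ring_1 mat"
  assumes A: "A \<in> carrier_mat n n" and r: "\<And>i. i < n \<Longrightarrow> r i < n"
  shows "det (mat n n (\<lambda>(i, j). A $$ (r i, j))) =
    det (mat n n (\<lambda>(i, j). 1\<^sub>m n $$ (r i, j))) * det A"
proof -
  have "mat n n (\<lambda>(i, j). A $$ (r i, j)) = mat n n (\<lambda>(i, j). 1\<^sub>m n $$ (r i, j)) * A"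
  proof (rule eq_matI)
    fix i j assume "i < dim_row (mat n n (\<lambda>(i, j). 1\<^sub>m n $$ (r i, j)) * A)"
      "j < dim_col (mat n n (\<lambda>(i, j). 1\<^sub>m n $$ (r i, j)) * A)"
    then have ij: "i < n" "j < n" using A by auto
    have "(mat n n (\<lambda>(i, j). 1\<^sub>m n $$ (r i, j)) * A) $$ (i, j)
        = (\<Sum>k = 0..<n. (if r i = k then 1 else 0) * A $$ (k, j))"
      using ij A r by (auto simp: scalar_prod_def intro!: sum.cong)
    also have "\<dots> = (\<Sum>k = 0..<n. if r i = k then A $$ (k, j) else 0)"
      by (intro sum.cong) auto
    also have "\<dots> = A $$ (r i, j)"
      using r[OF ij(1)] by simp
    finally show "mat n n (\<lambda>(i, j). A $$ (r i, j)) $$ (i, j) =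
        (mat n n (\<lambda>(i, j). 1\<^sub>m n $$ (r i, j)) * A) $$ (i, j)"
      using ij by simp
  qed (use A in auto)
  then show ?thesis
    using det_mult[of "mat n n (\<lambda>(i, j). 1\<^sub>m n $$ (r i, j))" n A] A by simp
qed

text \<open>One sum over index pairs, rather than a nested sum, lets a product of such entries
  expand over functions that choose a pair for each factor.\<close>

lemma transpose_mult_mult_index:
  fixes A B :: "'a :: comm_ring_1 mat"
  assumes A: "A \<in> carrier_mat n n" and B: "B \<in> carrier_mat n n" and ij: "i < n" "j < n"
  shows "(transpose_mat A * B * A) $$ (i, j) =
    (\<Sum>(k, l) \<in> {0..<n} \<times> {0..<n}. B $$ (k, l) * (A $$ (k, i) * A $$ (l, j)))"
proof -
  have "(transpose_mat A * B * A) $$ (i, j) =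
      (\<Sum>k = 0..<n. A $$ (k, i) * (\<Sum>l = 0..<n. B $$ (k, l) * A $$ (l, j)))"
    using A B ij by (auto simp: scalar_prod_def intro!: sum.cong)
  also have "\<dots> = (\<Sum>k = 0..<n. \<Sum>l = 0..<n. B $$ (k, l) * (A $$ (k, i) * A $$ (l, j)))"
    by (simp add: sum_distrib_left mult_ac)
  finally show ?thesis
    by (simp add: sum.cartesian_product)
qed

text \<open>Expanding the entries of \<open>A\<^sup>T B A\<close> groups the permutation sum into determinants of row
  selections of \<open>A\<close>. Each contributes \<open>det A\<close> times a factor independent of \<open>A\<close>, and \<open>A = I\<close>
  identifies the sum of these factors, so no distinction between injective and non-injective
  selections is needed.\<close>

lemma pfaffian_sum_congruence:
  fixes A B :: "'a :: comm_ring_1 mat"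
  assumes A: "A \<in> carrier_mat (2 * N) (2 * N)" and B: "B \<in> carrier_mat (2 * N) (2 * N)"
  shows "pfaffian_sum N (transpose_mat A * B * A) = det A * pfaffian_sum N B"
proof -
  let ?n = "2 * N"
  let ?G = "PiE {..<N} (\<lambda>_. {0..<?n} \<times> {0..<?n})"
  \<comment> \<open>A choice \<open>g\<close> of one index pair per \<open>i < N\<close> is
    flattened into a row selection on \<open>2 * N\<close> indices. First components fill the lower
    half and second components the upper half, in line with the pairing of \<open>i\<close> with
    \<open>i + N\<close>.\<close>
  define row where
    "row g i = (if i < N then fst (g i) else snd (g (i - N)))" for g :: "nat \<Rightarrow> nat \<times> nat" and i
  define c where "c = (\<Sum>g\<in>?G. (\<Prod>i<N. B $$ g i) *
    det (mat ?n ?n (\<lambda>(i, j). 1\<^sub>m ?n $$ (row g i, j))))"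
  have row: "row g i < ?n" if "g \<in> ?G" "i < ?n" for g i
  proof -
    have "g k \<in> {0..<?n} \<times> {0..<?n}" if "k < N" for k
      using PiE_mem[OF \<open>g \<in> ?G\<close>] that by blast
    from this[of i] this[of "i - N"] show ?thesis
      using \<open>i < ?n\<close> by (auto simp: row_def mem_Times_iff)
  qed
  have expand: "pfaffian_sum N (transpose_mat C * B * C) = c * det C"
    if C: "C \<in> carrier_mat ?n ?n" for C
  proof -
    have summand: "signof p * (\<Prod>i<N. (transpose_mat C * B * C) $$ (p i, p (i + N))) =
        (\<Sum>g\<in>?G. (\<Prod>i<N. B $$ g i) * (signof p * (\<Prod>j = 0..<?n. C $$ (row g j, p j))))"
      if p: "p permutes {0..<?n}" for p
    proof -
      have pn: "p i < ?n" if "i < ?n" for i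
        using permutes_in_image[OF p, of i] that by simp
      have "(\<Prod>i<N. (transpose_mat C * B * C) $$ (p i, p (i + N))) =
          (\<Prod>i<N. \<Sum>y \<in> {0..<?n} \<times> {0..<?n}.
             B $$ y * (C $$ (fst y, p i) * C $$ (snd y, p (i + N))))"
        by (intro prod.cong refl)
          (subst transpose_mult_mult_index[OF C B]; simp add: pn case_prod_unfold)
      also have "\<dots> = (\<Sum>g\<in>?G. \<Prod>i<N.
          B $$ g i * (C $$ (fst (g i), p i) * C $$ (snd (g i), p (i + N))))"
        by (rule prod_sum_PiE) auto
      also have "\<dots> = (\<Sum>g\<in>?G. (\<Prod>i<N. B $$ g i) * (\<Prod>j = 0..<?n. C $$ (row g j, p j)))"
        unfolding prod_lessThan_double prod.distrib[symmetric]
        by (intro sum.cong prod.cong refl) (simp add: row_def)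
      finally show ?thesis
        by (simp add: sum_distrib_left mult_ac)
    qed
    have "pfaffian_sum N (transpose_mat C * B * C) =
        (\<Sum>g\<in>?G. (\<Prod>i<N. B $$ g i) *
          (\<Sum>p | p permutes {0..<?n}. signof p * (\<Prod>j = 0..<?n. C $$ (row g j, p j))))"
      unfolding pfaffian_sum_def sum_distrib_left
      by (subst sum.swap, rule sum.cong) (use summand in auto)
    also have "\<dots> = (\<Sum>g\<in>?G. (\<Prod>i<N. B $$ g i) * det (mat ?n ?n (\<lambda>(i, j). C $$ (row g i, j))))"
    proof (intro sum.cong refl arg_cong2[of _ _ _ _ "(*)"])
      fix g
      have "det (mat ?n ?n (\<lambda>(i, j). C $$ (row g i, j))) =
          (\<Sum>p | p permutes {0..<?n}. signof p *
             (\<Prod>i = 0..<?n. mat ?n ?n (\<lambda>(i, j). C $$ (row g i, j)) $$ (i, p i)))"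
        by (rule det_def') simp
      also have "\<dots> = (\<Sum>p | p permutes {0..<?n}. signof p * (\<Prod>i = 0..<?n. C $$ (row g i, p i)))"
      proof (intro sum.cong refl arg_cong2[of _ _ _ _ "(*)"] prod.cong)
        fix p i assume "p \<in> {p. p permutes {0..<?n}}" "i \<in> {0..<?n}"
        then show "mat ?n ?n (\<lambda>(i, j). C $$ (row g i, j)) $$ (i, p i) = C $$ (row g i, p i)"
          using permutes_in_image[of p "{0..<?n}" i] by simp
      qed
      finally show "(\<Sum>p | p permutes {0..<?n}. signof p * (\<Prod>j = 0..<?n. C $$ (row g j, p j))) =
          det (mat ?n ?n (\<lambda>(i, j). C $$ (row g i, j)))" ..
    qed
    also have "\<dots> = c * det C"
      unfolding c_def sum_distrib_right
      by (intro sum.cong refl) (simp add: det_select_rows[OF C row] mult.assoc)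
    finally show ?thesis .
  qed
  have "pfaffian_sum N B = c"
    using expand[of "1\<^sub>m ?n"] B by simp
  then show ?thesis
    using expand[OF A] by (simp add: mult.commute)
qed

text \<open>Call a pair \<open>i\<close>, \<open>i + N\<close> reversed if
  \<open>N \<le> p i\<close>. Undoing one reversal costs one transposition, so induction on the
  number of reversed pairs applies.\<close>

lemma sign_pair_permutation:
  fixes p :: "nat \<Rightarrow> nat"
  assumes "p permutes {0..<2 * N}"
    and "\<And>i. i < N \<Longrightarrow> p (i + N) = p i + N \<or> p i = p (i + N) + N"
  shows "sign p = (-1) ^ card {i. i < N \<and> N \<le> p i}"
  using assms
proof (induction "card {i. i < N \<and> N \<le> p i}" arbitrary: p)
  case 0
  then have low: "p i < N" if "i < N" for i
    using that by (auto simp: not_le)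
  then have up: "p (i + N) = p i + N" if "i < N" for i
    using 0(3)[OF that] low[OF that] by auto
  have inj: "inj p"
    using 0(2) by (rule permutes_inj)
  \<comment> \<open>With no reversed pair, \<open>p\<close> acts on the upper half as the shifted
    copy \<open>s\<close> of its action \<open>r\<close> on the lower half. Hence
    \<open>sign p\<close> is the square of \<open>sign r\<close>.\<close>
  define r where "r = restrict_id p {..<N}"
  define s where "s = map_permutation {..<N} (\<lambda>i. i + N) r"
  have "p ` {..<N} = {..<N}"
    using low by (intro endo_inj_surj inj_on_subset[OF inj]) auto
  then have "bij_betw p {..<N} {..<N}"
    using inj_on_subset[OF inj] by (auto simp: bij_betw_def)
  then have r: "r permutes {..<N}"
    unfolding r_def by (rule permutes_restrict_id)
  have inj_shift: "inj_on (\<lambda>i. i + N) {..<N}"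
    by (auto simp: inj_on_def)
  have s: "s permutes (\<lambda>i. i + N) ` {..<N}"
    unfolding s_def by (intro map_permutation_permutes r inj_on_imp_bij_betw inj_shift)
  have "p x = (s \<circ> r) x" for x
  proof -
    consider "x < N" | y where "y < N" "x = y + N" | "2 * N \<le> x"
      by (metis add.commute le_Suc_ex mult_2 nat_add_left_cancel_less not_le)
    then show ?thesis
    proof cases
      case 1
      then have "s (p x) = p x"
        using low[OF 1] by (intro permutes_not_in[OF s]) auto
      then show ?thesis using 1 by (simp add: r_def)
    next
      case 2
      then have "s x = r y + N"
        unfolding s_def using map_permutation_apply[OF inj_shift, of y r] by simp
      moreover have "r x = x"
        using 2 by (simp add: r_def)
      ultimately show ?thesis using 2 up by (simp add: r_def)
    next
      case 3
      then have "x \<notin> (\<lambda>i. i + N) ` {..<N}"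
        by auto
      then have "s x = x" "r x = x" "p x = x"
        using permutes_not_in[OF s, of x] permutes_not_in[OF r, of x]
          permutes_not_in[OF 0(2), of x] 3 by auto
      then show ?thesis by simp
    qed
  qed
  then have "p = s \<circ> r" by blast
  moreover have "sign s = sign r"
    unfolding s_def by (intro sign_map_permutation inj_shift r) simp
  moreover have "permutation r" "permutation s"
    using r s by (auto intro: permutes_imp_permutation[rotated])
  ultimately have "sign p = 1"
    by (simp add: sign_compose)
  then show ?case by (simp flip: 0(1))
next
  case (Suc m)
  then have "{i. i < N \<and> N \<le> p i} \<noteq> {}"
    by (metis card.empty Zero_not_Suc)
  then obtain a where a: "a < N" "N \<le> p a" by blast
  let ?t = "Transposition.transpose a (a + N)"
  \<comment> \<open>Composing on the right exchanges the images of \<open>a\<close> and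
    \<open>a + N\<close>, which restores this pair and leaves all others as they were.\<close>
  define q where "q = p \<circ> ?t"
  have t: "?t permutes {0..<2 * N}"
    using a by (intro permutes_swap_id) auto
  have q: "q permutes {0..<2 * N}"
    unfolding q_def by (rule permutes_compose[OF t Suc.prems(1)])
  have q_a: "q a = p (a + N)" "q (a + N) = p a"
    by (simp_all add: q_def)
  have q_other: "q i = p i" "q (i + N) = p (i + N)" if "i < N" "i \<noteq> a" for i
    using that a by (simp_all add: q_def transpose_def)
  have "p a < 2 * N"
    using permutes_in_image[OF Suc.prems(1), of a] a by simp
  then have p_a: "p a = p (a + N) + N" "p (a + N) < N"
    using Suc.prems(2)[OF a(1)] permutes_in_image[OF Suc.prems(1), of "a + N"] a by auto
  have "{i. i < N \<and> N \<le> q i} = {i. i < N \<and> N \<le> p i} - {a}"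
    using q_a q_other p_a by force
  then have "card {i. i < N \<and> N \<le> q i} = m"
    using Suc(2) a by simp
  moreover have "q (i + N) = q i + N \<or> q i = q (i + N) + N" if "i < N" for i
    using that q_a q_other[of i] p_a Suc.prems(2)[OF that] by (cases "i = a") auto
  ultimately have "sign q = (-1) ^ m"
    using Suc(1)[of q] q by simp
  moreover have "sign q = - sign p"
    using t Suc.prems(1) a unfolding q_def
    by (subst sign_compose) (auto simp: sign_swap_id intro: permutes_imp_permutation[rotated])
  ultimately show ?case
    unfolding Suc(2)[symmetric] by simp
qed

lemma symplectic_J_carrier: "symplectic_J N \<in> carrier_mat (2 * N) (2 * N)"
  unfolding symplectic_J_def mult_2 by (rule four_block_carrier_mat) auto

lemma symplectic_J_index:
  assumes "i < 2 * N" "j < 2 * N"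
  shows "symplectic_J N $$ (i, j) = (if j = i + N then 1 else if i = j + N then - 1 else 0)"
  using assms by (auto simp: symplectic_J_def)

text \<open>Each reversed pair contributes a factor \<open>- 1\<close> to the product, and these
  signs multiply to exactly the sign of \<open>p\<close>, so the two cancel. If some pair is not
  mapped to a pair, an entry of \<open>J\<close> in the product is zero.\<close>

lemma pfaffian_sum_symplectic_J_term:
  assumes p: "p permutes {0..<2 * N}"
  shows "signof p * (\<Prod>i<N. symplectic_J N $$ (p i, p (i + N))) =
    (if \<forall>i<N. p (i + N) = p i + N \<or> p i = p (i + N) + N then 1 else 0 :: 'a :: field)"
proof -
  have pn: "p i < 2 * N" if "i < 2 * N" for i
    using permutes_in_image[OF p, of i] that by simp
  have J: "symplectic_J N $$ (p i, p (i + N)) =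
      (if p (i + N) = p i + N then 1 else if p i = p (i + N) + N then - 1 else 0 :: 'a)"
    if "i < N" for i
    using that by (intro symplectic_J_index pn) auto
  show ?thesis
  proof (cases "\<forall>i<N. p (i + N) = p i + N \<or> p i = p (i + N) + N")
    case True
    \<comment> \<open>The bound \<open>p (i + N) < 2 * N\<close> forces \<open>p i < N\<close> in
      the first alternative, so \<open>N \<le> p i\<close> alone decides the sign of the
      entry.\<close>
    have "(\<Prod>i<N. symplectic_J N $$ (p i, p (i + N))) =
        (\<Prod>i<N. if N \<le> p i then - 1 else 1 :: 'a)"
    proof (intro prod.cong refl)
      fix i assume "i \<in> {..<N}"
      then show "symplectic_J N $$ (p i, p (i + N)) = (if N \<le> p i then - 1 else 1 :: 'a)"
        using True J[of i] pn[of "i + N"] by auto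
    qed
    also have "\<dots> = (- 1) ^ card {i. i < N \<and> N \<le> p i}"
      by (simp add: prod.If_cases Int_def)
    finally show ?thesis
      using True sign_pair_permutation[OF p] by (simp flip: power_mult_distrib)
  next
    case False
    then obtain i where "i < N" "symplectic_J N $$ (p i, p (i + N)) = (0 :: 'a)"
      using J by auto
    then have "(\<Prod>i<N. symplectic_J N $$ (p i, p (i + N))) = (0 :: 'a)"
      by (intro prod_zero) auto
    then show ?thesis using False by auto
  qed
qed

lemma pfaffian_sum_symplectic_J_nonzero:
  "pfaffian_sum N (symplectic_J N :: 'a :: field_char_0 mat) \<noteq> 0"
proof -
  let ?P = "{p. p permutes {0..<2 * N}}"
  let ?Q = "{p \<in> ?P. \<forall>i<N. p (i + N) = p i + N \<or> p i = p (i + N) + N}"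
  have fin: "finite ?P"
    by (simp add: finite_permutations)
  have "pfaffian_sum N (symplectic_J N :: 'a mat) =
      (\<Sum>p\<in>?P. if \<forall>i<N. p (i + N) = p i + N \<or> p i = p (i + N) + N then 1 else 0)"
    unfolding pfaffian_sum_def by (intro sum.cong refl pfaffian_sum_symplectic_J_term) simp
  also have "\<dots> = of_nat (card ?Q)"
    using fin by (simp flip: sum.inter_filter)
  finally have eq: "pfaffian_sum N (symplectic_J N :: 'a mat) = of_nat (card ?Q)" .
  \<comment> \<open>The identity makes the count positive; characteristic 0 then keeps its image in
    the field nonzero.\<close>
  have "id \<in> ?Q"
    by (simp add: permutes_id)
  moreover have "finite ?Q"
    using fin by simp
  ultimately have "card ?Q \<noteq> 0"
    by (simp only: card_eq_0_iff) blast
  then show ?thesis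
    unfolding eq by simp
qed

theorem theorem2p3:
  fixes N :: nat and A :: "complex mat"
  assumes "N \<ge> 1" and "A \<in> Sp N"
  shows "det A = 1"
proof -
  have "A \<in> carrier_mat (2 * N) (2 * N)"
    and "transpose_mat A * symplectic_J N * A = symplectic_J N"
    using assms(2) by (auto simp: Sp_def)
  then have "det A * pfaffian_sum N (symplectic_J N) = pfaffian_sum N (symplectic_J N)"
    using pfaffian_sum_congruence[OF _ symplectic_J_carrier] by metis
  then show ?thesis
    using pfaffian_sum_symplectic_J_nonzero[of N, where 'a = complex] by simp
qed

end
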